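(* Let $x\ge0$, let $N\ge1$ be an integer, and let $\hat\psi(x)$ be the Monte Carlo estimate of the ruin probability $\psi(x)$ based on $N$ independent simulations of the surplus process $(X_t(x))_{t\ge0}$. Then for any $\varepsilon>0$, $$\mathbb P\big[\,|\psi(x)-\hat\psi(x)|>\varepsilon\,\big]\le 2e^{-2\varepsilon^2N}.$$
   Context: Let $(\Omega,\mathfrak F,\mathbb P)$ be a complete probability space on which all objects are defined. Let $c>0$ and $\lambda>0$ be constants. Let $(\xi_i)_{i\ge1}$ (claim sizes) be nonnegative i.i.d. random variables with c.d.f. $F_1$ and finite mean $\mu_1$. Let $(\eta_i)_{i\ge1}$ (additional funds) be nonnegative i.i.d. random variables with c.d.f. $F_2$ and finite mean $\mu_2$. Let $(N_t)_{t\ge0}$ be a homogeneous Poisson process with intensity $\lambda$. The sequences $(\xi_i)_{i\ge1}$, $(\eta_i)_{i\ge1}$ and the process $(N_t)_{t\ge0}$ are mutually independent. Assume that $\mathbb P[\xi_i-\eta_i>0]>0$ and $\mathbb P[\xi_i-\eta_i<0]>0$. For an initial surplus $x\ge0$, the surplus process is $$X_t(x)=x+ct-\sum_{i=1}^{N_t}(\xi_i-\eta_i),\quad t\ge0,$$ where the sum is $0$ if $N_t=0$. The ruin time is $\tau(x)=\inf\{t\ge0: X_t(x)<0\}$, with $\tau(x)=\infty$ if $X_t(x)\ge0$ for all $t\ge0$. The infinite-horizon ruin probability is $\psi(x)=\mathbb P[\tau(x)<\infty]$. The Monte Carlo estimate $\hat\psi(x)$ is the number of simulations that lead to ruin (i.e.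 for which the simulated path has finite ruin time) divided by the total number $N$ of simulations. Simulations are independent copies of the process $(X_t(x))_{t\ge0}$. *)

theory Defs
  imports "HOL-Probability.Probability"
begin

context prob_space
begin

(* The events determined by the family (X i), i in I, of S-valued random variables. *)
definition process_events ::
  "'i set \<Rightarrow> 'b measure \<Rightarrow> ('i \<Rightarrow> 'a \<Rightarrow> 'b) \<Rightarrow> 'a set set" where
  "process_events I S X =
     {(\<lambda>\<omega>. \<lambda>i\<in>I. X i \<omega>) -` A \<inter> space M | A. A \<in> sets (PiM I (\<lambda>_. S))}"

(* Path properties are only required almost surely. Since almost all paths are
   nondecreasing, the truncated subtraction on nat is the genuine increment
   almost surely. *)
definition poisson_process :: "real \<Rightarrow> (real \<Rightarrow> 'a \<Rightarrow> nat) \<Rightarrow> bool" where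
  "poisson_process rate N \<longleftrightarrow>
     (\<forall>t\<ge>0. random_variable (count_space UNIV) (N t)) \<and>
     (AE \<omega> in M. N 0 \<omega> = 0) \<and>
     (AE \<omega> in M. mono_on {0..} (\<lambda>t. N t \<omega>)) \<and>
     (AE \<omega> in M. \<forall>t\<ge>0. continuous (at_right t) (\<lambda>s. N s \<omega>)) \<and>
     (\<forall>n t. 0 \<le> t 0 \<and> (\<forall>i<n. t i \<le> t (Suc i)) \<longrightarrow>
        indep_vars (\<lambda>_. count_space UNIV)
          (\<lambda>i \<omega>. N (t (Suc i)) \<omega> - N (t i) \<omega>) {..<n::nat}) \<and>
     (\<forall>s t. 0 \<le> s \<and> s < t \<longrightarrow>
        distr M (count_space UNIV) (\<lambda>\<omega>. N t \<omega> - N s \<omega>) =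
          measure_pmf (poisson_pmf (rate * (t - s))))"

definition iid_with ::
  "(nat \<Rightarrow> 'a \<Rightarrow> real) \<Rightarrow> (real \<Rightarrow> real) \<Rightarrow> real \<Rightarrow> bool" where
  "iid_with Z F \<mu> \<longleftrightarrow>
     indep_vars (\<lambda>_. borel) Z {1..} \<and>
     (\<forall>i\<ge>1. cdf (distr M borel (Z i)) = F \<and>
            integrable M (Z i) \<and> expectation (Z i) = \<mu>)"

(* Y 1, ..., Y n are independent copies of the real-valued process X on [0, \<infinity>):
   they are independent as random elements of the path space, each with the law of X.
   That law lives on the product sigma-algebra and hence only fixes the
   finite-dimensional distributions, so the path regularity of the surplus process
   is required separately: without it a copy could be altered at a random time,
   which would change the ruin event but not the law. *)
definition independent_copies ::
  "nat \<Rightarrow> (nat \<Rightarrow> real \<Rightarrow> 'a \<Rightarrow> real) \<Rightarrow> (real \<Rightarrow> 'a \<Rightarrow> real) \<Rightarrow> bool" where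
  "independent_copies n Y X \<longleftrightarrow>
     indep_vars (\<lambda>_. PiM {0..} (\<lambda>_. borel)) (\<lambda>k \<omega>. \<lambda>t\<in>{0..}. Y k t \<omega>) {1..n} \<and>
     (\<forall>k\<in>{1..n}.
        distr M (PiM {0..} (\<lambda>_. borel)) (\<lambda>\<omega>. \<lambda>t\<in>{0..}. Y k t \<omega>) =
        distr M (PiM {0..} (\<lambda>_. borel)) (\<lambda>\<omega>. \<lambda>t\<in>{0..}. X t \<omega>)) \<and>
     (\<forall>k\<in>{1..n}. AE \<omega> in M. \<forall>t\<ge>0. continuous (at_right t) (\<lambda>s. Y k s \<omega>))"

end

locale risk_model = prob_space M + complete_measure M
  for M :: "'a measure" +
  fixes c lam :: real
    and F1 F2 :: "real \<Rightarrow> real"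
    and \<mu>1 \<mu>2 :: real
    and \<xi> \<eta> :: "nat \<Rightarrow> 'a \<Rightarrow> real"
    and N :: "real \<Rightarrow> 'a \<Rightarrow> nat"
  assumes c_pos: "c > 0"
    and intensity_pos: "lam > 0"
    and claims_nonneg: "\<And>i. i \<ge> 1 \<Longrightarrow> AE \<omega> in M. \<xi> i \<omega> \<ge> 0"
    and claims_iid: "iid_with \<xi> F1 \<mu>1"
    and funds_nonneg: "\<And>i. i \<ge> 1 \<Longrightarrow> AE \<omega> in M. \<eta> i \<omega> \<ge> 0"
    and funds_iid: "iid_with \<eta> F2 \<mu>2"
    and poisson: "poisson_process lam N"
    and mutually_independent:
      "indep_sets
         (\<lambda>j. [process_events {1..} borel \<xi>,
               process_events {1..} borel \<eta>,
               process_events {0..} (count_space UNIV) N] ! j) {0, 1, 2}"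
    and net_claim_pos: "\<And>i. i \<ge> 1 \<Longrightarrow> prob {\<omega> \<in> space M. \<xi> i \<omega> - \<eta> i \<omega> > 0} > 0"
    and net_claim_neg: "\<And>i. i \<ge> 1 \<Longrightarrow> prob {\<omega> \<in> space M. \<xi> i \<omega> - \<eta> i \<omega> < 0} > 0"

definition surplus ::
  "real \<Rightarrow> (nat \<Rightarrow> 'a \<Rightarrow> real) \<Rightarrow> (nat \<Rightarrow> 'a \<Rightarrow> real) \<Rightarrow> (real \<Rightarrow> 'a \<Rightarrow> nat) \<Rightarrow>
   real \<Rightarrow> real \<Rightarrow> 'a \<Rightarrow> real" where
  "surplus c \<xi> \<eta> N x t \<omega> = x + c * t - (\<Sum>i = 1..N t \<omega>. \<xi> i \<omega> - \<eta> i \<omega>)"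

(* The infimum of the empty set in ereal is \<infinity>. *)
definition ruin_time :: "(real \<Rightarrow> 'a \<Rightarrow> real) \<Rightarrow> 'a \<Rightarrow> ereal" where
  "ruin_time X \<omega> = Inf {ereal t | t. t \<ge> 0 \<and> X t \<omega> < 0}"

definition ruin_probability :: "'a measure \<Rightarrow> (real \<Rightarrow> 'a \<Rightarrow> real) \<Rightarrow> real" where
  "ruin_probability M X = measure M {\<omega> \<in> space M. ruin_time X \<omega> < \<infinity>}"

definition monte_carlo_estimate ::
  "nat \<Rightarrow> (nat \<Rightarrow> real \<Rightarrow> 'a \<Rightarrow> real) \<Rightarrow> 'a \<Rightarrow> real" where
  "monte_carlo_estimate n Y \<omega> =
     real (card {k \<in> {1..n}. ruin_time (Y k) \<omega> < \<infinity>}) / real n"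

end

theory Submission
  imports Defs
begin

text \<open>
  A right-continuous path that is negative at some time is negative at some rational time.
  Up to a null set, ruin is therefore an event of the product sigma-algebra on path space:
  its probability depends only on the finite-dimensional distributions, and the ruin events of
  independent copies are independent. The estimate is thus almost surely the mean of i.i.d.
  indicators with expectation \<open>\<psi>(x)\<close>, and Hoeffding's inequality applies.
\<close>

lemma ruin_time_finite_iff: "ruin_time X \<omega> < \<infinity> \<longleftrightarrow> (\<exists>t\<ge>0. X t \<omega> < 0)"
  unfolding ruin_time_def Inf_less_iff by auto

text \<open>Ruin quantified over all real times is an uncountable union, and the product
  sigma-algebra sees only countably many coordinates. Restricting to rational times gives a
  countable union of coordinate events.\<close>

definition rational_ruin :: "(real \<Rightarrow> real) set" where
  "rational_ruin = {f \<in> space (PiM {0..} (\<lambda>_. borel)). \<exists>q\<in>\<rat> \<inter> {0..}. f q < 0}"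

lemma sets_rational_ruin: "rational_ruin \<in> sets (PiM {0..} (\<lambda>_. borel))"
proof -
  have "countable (\<rat> \<inter> {0::real..})"
    using countable_rat by blast
  then have "(\<Union>q\<in>\<rat> \<inter> {0..}. {f \<in> space (PiM {0..} (\<lambda>_. borel)). (f :: real \<Rightarrow> real) q < 0})
    \<in> sets (PiM {0..} (\<lambda>_. borel))"
    by (intro sets.countable_UN') auto
  also have "(\<Union>q\<in>\<rat> \<inter> {0..}. {f \<in> space (PiM {0..} (\<lambda>_. borel)). (f :: real \<Rightarrow> real) q < 0}) = rational_ruin"
    by (auto simp: rational_ruin_def)
  finally show ?thesis .
qed

text \<open>Being negative is an open condition, so it persists on some interval to the right of
  \<open>t\<close>, and that interval contains a rational.\<close>

lemma right_continuous_negative_at_rational: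
  fixes f :: "real \<Rightarrow> real"
  assumes "continuous (at_right t) f" and "f t < 0"
  obtains q where "q \<in> \<rat>" "t < q" "f q < 0"
proof -
  have "eventually (\<lambda>s. f s < 0) (at_right t)"
    using assms by (simp add: continuous_within order_tendstoD)
  then obtain b where b: "t < b" "\<And>s. t < s \<Longrightarrow> s < b \<Longrightarrow> f s < 0"
    by (auto simp: eventually_at_right_field)
  with Rats_dense_in_real[of t b] show thesis
    using that by blast
qed

lemma rational_ruin_iff_ruin:
  assumes "\<forall>t\<ge>0. continuous (at_right t) (\<lambda>s. X s \<omega>)"
  shows "(\<lambda>t\<in>{0..}. X t \<omega>) \<in> rational_ruin \<longleftrightarrow> ruin_time X \<omega> < \<infinity>"
proof -
  have "(\<lambda>t\<in>{0..}. X t \<omega>) \<in> rational_ruin \<longleftrightarrow> (\<exists>q\<in>\<rat> \<inter> {0..}. X q \<omega> < 0)"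
    by (auto simp: rational_ruin_def space_PiM)
  also have "\<dots> \<longleftrightarrow> (\<exists>t\<ge>0. X t \<omega> < 0)"
  proof
    assume "\<exists>t\<ge>0. X t \<omega> < 0"
    then obtain t where t: "t \<ge> 0" "X t \<omega> < 0"
      by blast
    then obtain q where "q \<in> \<rat>" "t < q" "X q \<omega> < 0"
      using assms right_continuous_negative_at_rational[of t "\<lambda>s. X s \<omega>"] by blast
    \<comment> \<open>The rational lies to the right of \<open>t\<close>, so it stays inside the
      time domain \<open>{0..}\<close>.\<close>
    then show "\<exists>q\<in>\<rat> \<inter> {0..}. X q \<omega> < 0"
      using t by (intro bexI[of _ q]) auto
  qed auto
  finally show ?thesis
    by (simp only: ruin_time_finite_iff)
qed

lemma surplus_right_continuous:
  assumes "continuous (at_right t) (\<lambda>s. N s \<omega>)"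
  shows "continuous (at_right t) (\<lambda>s. surplus c \<xi> \<eta> N x s \<omega>)"
proof -
  \<comment> \<open>The topology on \<open>nat\<close> is discrete, so a right limit of the counting
    path is attained: the number of summands is constant just after \<open>t\<close>.\<close>
  have "eventually (\<lambda>s. N s \<omega> = N t \<omega>) (at_right t)"
    using assms by (simp add: continuous_within tendsto_discrete)
  then have "((\<lambda>s. \<Sum>i = 1..N s \<omega>. \<xi> i \<omega> - \<eta> i \<omega>)
    \<longlongrightarrow> (\<Sum>i = 1..N t \<omega>. \<xi> i \<omega> - \<eta> i \<omega>)) (at_right t)"
    by (intro tendsto_eventually) (auto elim: eventually_mono)
  then show ?thesis
    unfolding continuous_within surplus_def by (intro tendsto_intros)
qed

context risk_model
begin

lemma surplus_measurable:
  assumes "t \<ge> 0"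
  shows "surplus c \<xi> \<eta> N x t \<in> borel_measurable M"
proof -
  have meas: "\<xi> i \<in> borel_measurable M" "\<eta> i \<in> borel_measurable M" if "i \<ge> 1" for i
    using that claims_iid funds_iid by (auto simp: iid_with_def indep_vars_def)
  have "(\<lambda>\<omega>. \<Sum>i = 1..m. \<xi> i \<omega> - \<eta> i \<omega>) \<in> borel_measurable M" for m
    by (intro borel_measurable_sum borel_measurable_diff meas) auto
  moreover have "N t \<in> measurable M (count_space UNIV)"
    using poisson assms by (simp add: poisson_process_def)
  \<comment> \<open>The number of summands is random but takes countably many values, so it suffices
    that each sum of fixed length is measurable.\<close>
  ultimately have "(\<lambda>\<omega>. \<Sum>i = 1..N t \<omega>. \<xi> i \<omega> - \<eta> i \<omega>) \<in> borel_measurable M"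
    by (rule measurable_compose_countable)
  then show ?thesis
    unfolding surplus_def by measurable
qed

lemma surplus_path_measurable:
  "(\<lambda>\<omega>. \<lambda>t\<in>{0..}. surplus c \<xi> \<eta> N x t \<omega>) \<in> measurable M (PiM {0..} (\<lambda>_. borel))"
  by (intro measurable_restrict surplus_measurable) simp

lemma AE_surplus_right_continuous:
  "AE \<omega> in M. \<forall>t\<ge>0. continuous (at_right t) (\<lambda>s. surplus c \<xi> \<eta> N x s \<omega>)"
proof -
  have "AE \<omega> in M. \<forall>t\<ge>0. continuous (at_right t) (\<lambda>s. N s \<omega>)"
    using poisson by (simp add: poisson_process_def)
  then show ?thesis
    by eventually_elim (simp add: surplus_right_continuous)
qed

text \<open>Expresses \<psi>(x) as the mean of a bounded measurable function of the path, the form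
  in which it serves as the common mean in Hoeffding's inequality.\<close>

lemma ruin_probability_eq_expectation:
  "ruin_probability M (surplus c \<xi> \<eta> N x) =
    expectation (\<lambda>\<omega>. indicator rational_ruin (\<lambda>t\<in>{0..}. surplus c \<xi> \<eta> N x t \<omega>))"
proof -
  define A where "A = (\<lambda>\<omega>. \<lambda>t\<in>{0..}. surplus c \<xi> \<eta> N x t \<omega>) -` rational_ruin \<inter> space M"
  define B where "B = {\<omega> \<in> space M. ruin_time (surplus c \<xi> \<eta> N x) \<omega> < \<infinity>}"
  have A: "A \<in> sets M"
    unfolding A_def by (rule measurable_sets[OF surplus_path_measurable sets_rational_ruin])
  have AB: "AE \<omega> in M. \<omega> \<in> A \<longleftrightarrow> \<omega> \<in> B"
    using AE_surplus_right_continuous[of x]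
    by eventually_elim (auto simp: A_def B_def rational_ruin_iff_ruin)
  \<comment> \<open>The ruin event differs from the measurable event \<open>A\<close> only inside a
    null set, so completeness of \<open>M\<close> makes it measurable.\<close>
  have "B \<in> sets M"
    by (rule in_sets_AE[OF AB A]) (auto simp: B_def)
  then have "measure M A = measure M B"
    using AB A by (intro finite_measure_eq_AE)
  also have "\<dots> = ruin_probability M (surplus c \<xi> \<eta> N x)"
    by (simp add: B_def ruin_probability_def)
  also have "measure M A = expectation (indicator A)"
    using A by simp
  also have "\<dots> = expectation (\<lambda>\<omega>. indicator rational_ruin (\<lambda>t\<in>{0..}. surplus c \<xi> \<eta> N x t \<omega>))"
    by (intro Bochner_Integration.integral_cong) (auto simp: A_def indicator_def)
  finally show ?thesis by simp
qed

lemma monte_carlo_estimate_concentration: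
  assumes "n \<ge> 1" and copies: "independent_copies n Y (surplus c \<xi> \<eta> N x)" and "\<epsilon> > 0"
  shows "prob {\<omega> \<in> space M.
      \<bar>ruin_probability M (surplus c \<xi> \<eta> N x) - monte_carlo_estimate n Y \<omega>\<bar> > \<epsilon>}
    \<le> 2 * exp (- 2 * \<epsilon>\<^sup>2 * real n)"
proof -
  let ?P = "PiM {0..} (\<lambda>_. borel) :: (real \<Rightarrow> real) measure"
  let ?X = "\<lambda>\<omega>. \<lambda>t\<in>{0..}. surplus c \<xi> \<eta> N x t \<omega>"
  let ?Y = "\<lambda>k \<omega>. \<lambda>t\<in>{0..}. Y k t \<omega>"
  let ?I = "indicator rational_ruin :: (real \<Rightarrow> real) \<Rightarrow> real"
  let ?\<psi> = "ruin_probability M (surplus c \<xi> \<eta> N x)"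
  have I: "?I \<in> borel_measurable ?P"
    by (intro borel_measurable_indicator sets_rational_ruin)
  have indep: "indep_vars (\<lambda>_. ?P) ?Y {1..n}"
    and law: "\<And>k. k \<in> {1..n} \<Longrightarrow> distr M ?P (?Y k) = distr M ?P ?X"
    and rc: "\<And>k. k \<in> {1..n} \<Longrightarrow> AE \<omega> in M. \<forall>t\<ge>0. continuous (at_right t) (\<lambda>s. Y k s \<omega>)"
    using copies by (auto simp: independent_copies_def)
  have Y: "?Y k \<in> measurable M ?P" if "k \<in> {1..n}" for k
    using indep that by (simp add: indep_vars_def)
  interpret H: Hoeffding_ineq_iid M "{1..n}" "\<lambda>k \<omega>. ?I (?Y k \<omega>)" "\<lambda>\<omega>. ?I (?X \<omega>)" 0 1 ?\<psi>
  proof unfold_locales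
    \<comment> \<open>Each indicator is one fixed measurable function of a whole path, so both
      independence and equality of laws pass from the paths to the indicators.\<close>
    show "indep_vars (\<lambda>_. borel) (\<lambda>k \<omega>. ?I (?Y k \<omega>)) {1..n}"
      using indep I by (rule indep_vars_compose2)
    show "distr M borel (\<lambda>\<omega>. ?I (?Y k \<omega>)) = distr M borel (\<lambda>\<omega>. ?I (?X \<omega>))" if "k \<in> {1..n}" for k
      using distr_distr[OF I Y[OF that]] distr_distr[OF I surplus_path_measurable[of x]] law[OF that]
      by (simp add: comp_def)
    show "(\<lambda>\<omega>. ?I (?X \<omega>)) \<in> borel_measurable M"
      using measurable_compose[OF surplus_path_measurable I] .
    show "?\<psi> \<equiv> expectation (\<lambda>\<omega>. ?I (?X \<omega>))"
      by (simp add: ruin_probability_eq_expectation)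
  qed (auto simp: indicator_def)
  have "AE \<omega> in M. \<forall>k\<in>{1..n}. \<forall>t\<ge>0. continuous (at_right t) (\<lambda>s. Y k s \<omega>)"
    by (intro AE_finite_allI rc) auto
  then have "AE \<omega> in M. (\<Sum>k = 1..n. ?I (?Y k \<omega>)) / n = monte_carlo_estimate n Y \<omega>"
  proof eventually_elim
    case (elim \<omega>)
    \<comment> \<open>Deleting \<open>ereal_infty_less\<close> keeps the condition in the form
      \<open>ruin_time (Y k) \<omega> < \<infinity>\<close>, which
      \<open>rational_ruin_iff_ruin\<close> produces.\<close>
    then have "(\<Sum>k = 1..n. ?I (?Y k \<omega>)) = (\<Sum>k = 1..n. if ruin_time (Y k) \<omega> < \<infinity> then 1 else 0)"
      by (intro sum.cong) (auto simp: indicator_def rational_ruin_iff_ruin simp del: ereal_infty_less)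
    also have "\<dots> = real (card {k \<in> {1..n}. ruin_time (Y k) \<omega> < \<infinity>})"
      by (subst sum.inter_filter[symmetric]) simp_all
    finally show ?case
      by (simp add: monte_carlo_estimate_def)
  qed
  then have "prob {\<omega> \<in> space M. \<bar>?\<psi> - monte_carlo_estimate n Y \<omega>\<bar> > \<epsilon>}
    \<le> prob {\<omega> \<in> space M. \<bar>(\<Sum>k = 1..n. ?I (?Y k \<omega>)) / n - ?\<psi>\<bar> \<ge> \<epsilon>}"
  \<comment> \<open>Almost sure inclusion suffices here, and measurability is checked for the larger
    event only. The strict deviation is relaxed to the non-strict one that Hoeffding's inequality
    bounds.\<close>
  proof (intro finite_measure_mono_AE)
    assume "AE \<omega> in M. (\<Sum>k = 1..n. ?I (?Y k \<omega>)) / n = monte_carlo_estimate n Y \<omega>"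
    then show "AE \<omega> in M. \<omega> \<in> {\<omega> \<in> space M. \<bar>?\<psi> - monte_carlo_estimate n Y \<omega>\<bar> > \<epsilon>} \<longrightarrow>
      \<omega> \<in> {\<omega> \<in> space M. \<bar>(\<Sum>k = 1..n. ?I (?Y k \<omega>)) / n - ?\<psi>\<bar> \<ge> \<epsilon>}"
      by eventually_elim auto
  qed measurable
  also have "\<dots> \<le> 2 * exp (- 2 * \<epsilon>\<^sup>2 * real n)"
    \<comment> \<open>The indicators range over [0, 1], so the squared range dividing Hoeffding's
      exponent equals 1; \<open>n \<ge> 1\<close> makes the sample nonempty.\<close>
    using H.Hoeffding_ineq_abs_ge'[of \<epsilon>] assms by (simp add: mult_ac)
  finally show ?thesis .
qed

end

theorem proposition2:
  fixes M :: "'a measure"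
    and c lam \<mu>1 \<mu>2 x \<epsilon> :: real
    and F1 F2 :: "real \<Rightarrow> real"
    and \<xi> \<eta> :: "nat \<Rightarrow> 'a \<Rightarrow> real"
    and N :: "real \<Rightarrow> 'a \<Rightarrow> nat"
    and n :: nat
    and Y :: "nat \<Rightarrow> real \<Rightarrow> 'a \<Rightarrow> real"
  assumes "risk_model M c lam F1 F2 \<mu>1 \<mu>2 \<xi> \<eta> N"
    and "x \<ge> 0"
    and "n \<ge> 1"
    and "prob_space.independent_copies M n Y (surplus c \<xi> \<eta> N x)"
    and "\<epsilon> > 0"
  shows "measure M {\<omega> \<in> space M.
           \<bar>ruin_probability M (surplus c \<xi> \<eta> N x) - monte_carlo_estimate n Y \<omega>\<bar> > \<epsilon>}
         \<le> 2 * exp (- 2 * \<epsilon>\<^sup>2 * real n)"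
  using risk_model.monte_carlo_estimate_concentration[OF assms(1,3,4,5)] .

end
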